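(* There are absolute constants $c,C>0$ such that the following holds for every $2<p\le\infty$ and every integer $r\ge2$. Put $D=2^{128r}$ and $Y_{p,r}=\ell_p^r(\ell_2^D)$, and let $e_{i,s}$ ($1\le i\le r$, $1\le s\le D$) denote the $s$th standard unit vector in the $i$th copy of $\ell_2^D$. Then the set \[ T_{p,r}=\left\{r^{-1/p}\sum_{i=1}^r e_{i,s_i}:\ 1\le s_i\le D \text{ for } 1\le i\le r\right\} \] is contained in the unit sphere of $Y_{p,r}$ and satisfies \[ |T_{p,r}|=2^{128r^2},\qquad \gamma_2(T_{p,r};Y_{p,r})\le Cr, \] and \[ \gamma_2(\operatorname{conv} T_{p,r};Y_{p,r})\ge c\,r^{3/2-1/p}. \]
   Context: All Banach spaces are real, and $1/\infty=0$. The space $\ell_p^r(\ell_2^D)$ consists of $x=(x^{(1)},\dots,x^{(r)})$ with $x^{(i)}\in\mathbb R^D$, with norm $\|x\|=\left(\sum_{i=1}^r\|x^{(i)}\|_2^p\right)^{1/p}$ for $p<\infty$ and $\|x\|=\max_i\|x^{(i)}\|_2$ for $p=\infty$, where $\|\cdot\|_2$ is the Euclidean norm. An admissible sequence on a metric space $(K,d)$ is a refining sequence of partitions $(\mathcal A_n)_{n\ge0}$ of $K$ (each $\mathcal A_{n+1}$ refines $\mathcal A_n$) such that $|\mathcal A_0|=1$ and $|\mathcal A_n|\le2^{2^n}$ for $n\ge1$. For $x\in K$, $\mathcal A_n(x)$ is the element of $\mathcal A_n$ containing $x$. Define \[ \gamma_2(K,d)=\inf_{(\mathcal A_n)}\sup_{x\in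 K}\sum_{n\ge0}2^{n/2}\operatorname{diam}\bigl(\mathcal A_n(x)\bigr), \] the infimum being over all admissible sequences. For a subset $K$ of a Banach space $X$, $\gamma_2(K;X)$ is $\gamma_2(K,d)$ with $d$ the metric induced by the norm of $X$. $\operatorname{conv}T$ is the convex hull of $T$. *)

theory Defs
  imports "HOL-Analysis.Analysis" "HOL-Library.Function_Algebras" "HOL-Library.Disjoint_Sets"
begin

text \<open>
  The dimension \<open>D = 2 ^ (128 * r)\<close> of the Euclidean blocks depends on the quantified variable
  \<open>r\<close>, so vectors are functions \<open>nat \<Rightarrow> nat \<Rightarrow> real\<close> supported on
  \<open>{1..r} \<times> {1..D}\<close>, with \<open>x i\<close> the \<open>i\<close>-th block. Pointwise scalar multiplication
  complements the pointwise addition of \<^theory>\<open>HOL-Library.Function_Algebras\<close>, so that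
  \<open>convex hull\<close> applies to sets of such functions.
\<close>

instantiation "fun" :: (type, real_vector) real_vector
begin

definition scaleR_fun_def: "c *\<^sub>R f = (\<lambda>x. c *\<^sub>R f x)"

instance
  by standard (simp_all add: scaleR_fun_def fun_eq_iff scaleR_add_right scaleR_add_left)

end

lemma scaleR_fun_apply [simp]: "(c *\<^sub>R f) x = c *\<^sub>R f x"
  by (simp add: scaleR_fun_def)


definition admissible :: "'a set \<Rightarrow> (nat \<Rightarrow> 'a set set) \<Rightarrow> bool" where
  "admissible K \<A> \<longleftrightarrow>
     (\<forall>n. partition_on K (\<A> n)) \<and>
     (\<forall>n. refines K (\<A> (Suc n)) (\<A> n)) \<and>
     card (\<A> 0) = 1 \<and>
     (\<forall>n\<ge>1. finite (\<A> n) \<and> card (\<A> n) \<le> 2 ^ (2 ^ n))"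

definition part_of :: "'a set set \<Rightarrow> 'a \<Rightarrow> 'a set" where
  "part_of P x = (THE A. A \<in> P \<and> x \<in> A)"

text \<open>
  Diameters and \<open>\<gamma>\<^sub>2\<close> are extended nonnegative reals: the diameter of an unbounded set,
  a divergent series and an unbounded supremum all have the value \<open>\<infinity>\<close>.
\<close>

definition ediam :: "('a \<Rightarrow> 'a \<Rightarrow> real) \<Rightarrow> 'a set \<Rightarrow> ennreal" where
  "ediam d A = (SUP x\<in>A. SUP y\<in>A. ennreal (d x y))"

definition gamma2 :: "'a set \<Rightarrow> ('a \<Rightarrow> 'a \<Rightarrow> real) \<Rightarrow> ennreal" where
  "gamma2 K d =
     (INF \<A>\<in>{\<A>. admissible K \<A>}.
        SUP x\<in>K. \<Sum>n. ennreal (2 powr (real n / 2)) * ediam d (part_of (\<A> n) x))"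

text \<open>\<open>gamma2_norm K N\<close> is \<open>\<gamma>\<^sub>2(K; X)\<close> for a subset \<open>K\<close> of a space \<open>X\<close> with norm \<open>N\<close>.\<close>

definition gamma2_norm :: "'a::real_vector set \<Rightarrow> ('a \<Rightarrow> real) \<Rightarrow> ennreal" where
  "gamma2_norm K N = gamma2 K (\<lambda>x y. N (x - y))"


definition lp_l2_space :: "nat \<Rightarrow> nat \<Rightarrow> (nat \<Rightarrow> nat \<Rightarrow> real) set" where
  "lp_l2_space r D = {x. \<forall>i s. i \<notin> {1..r} \<or> s \<notin> {1..D} \<longrightarrow> x i s = 0}"

definition lp_l2_norm :: "ereal \<Rightarrow> nat \<Rightarrow> nat \<Rightarrow> (nat \<Rightarrow> nat \<Rightarrow> real) \<Rightarrow> real" where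
  "lp_l2_norm p r D x =
     (if p = \<infinity> then Max ((\<lambda>i. L2_set (x i) {1..D}) ` {1..r})
      else (\<Sum>i=1..r. L2_set (x i) {1..D} powr real_of_ereal p) powr (1 / real_of_ereal p))"

definition unit_vec :: "nat \<Rightarrow> nat \<Rightarrow> (nat \<Rightarrow> nat \<Rightarrow> real)" where
  "unit_vec i s = (\<lambda>j t. if j = i \<and> t = s then 1 else 0)"

text \<open>\<open>real_of_ereal (1 / p)\<close> is \<open>0\<close> for \<open>p = \<infinity>\<close>.\<close>

definition T_set :: "ereal \<Rightarrow> nat \<Rightarrow> nat \<Rightarrow> (nat \<Rightarrow> nat \<Rightarrow> real) set" where
  "T_set p r D =
     {real r powr (- real_of_ereal (1 / p)) *\<^sub>R (\<Sum>i=1..r. unit_vec i (s i)) | s.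
        \<forall>i\<in>{1..r}. s i \<in> {1..D}}"

end

theory Submission
  imports Defs
begin

text \<open>
  The set \<open>T\<close> has diameter at most \<open>2\<close>, so for the upper bound it suffices to use the trivial partition
  until \<open>2 ^ 2 ^ n\<close> reaches the cardinality of \<open>T\<close>, and singletons from then on.

  For the lower bound, \<open>conv T\<close> is \<open>r\<^bsup>-1/p\<^esup>\<close> times a product of \<open>r\<close> simplices. A separate scale is used
  in each block: in block \<open>i\<close> take the averages of \<open>2 ^ i\<close> unit vectors, one freely chosen from each of
  \<open>2 ^ i\<close> disjoint groups of size \<open>2 ^ (128 * r - i)\<close>. Two such averages that differ in at least half
  of the groups have distance of order \<open>2 powr (- i / 2)\<close>, while few choices agree with a given one
  in half of the groups. Let \<open>2 ^ k\<close> be about \<open>r\<close>. Counting shows that, for a uniformly random choice in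
  all blocks, the probability that the cell of \<open>\<A> (i + k)\<close> is so small that block \<open>i\<close> varies
  in at most half of the groups is at most \<open>2 powr (- i)\<close>. By a union bound a single point avoids this for all
  \<open>i \<le> r\<close>; each \<open>i\<close> then contributes about
  \<open>2 powr ((i + k) / 2) * 2 powr (- i / 2) \<approx> sqrt r\<close> to its sum.
\<close>

section \<open>The mixed norm in terms of its Euclidean blocks\<close>

lemma sum_fun_apply: "(\<Sum>i\<in>A. f i) x = (\<Sum>i\<in>A. f i x)"
  for f :: "'i \<Rightarrow> 'a \<Rightarrow> 'b::comm_monoid_add"
  by (induction A rule: infinite_finite_induct) auto

lemma lp_l2_norm_ge_block:
  assumes "2 < p" "i \<in> {1..r}"
  shows "L2_set (x i) {1..D} \<le> lp_l2_norm p r D x"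
proof (cases p)
  case (real q)
  with assms have q: "q > 2" by simp
  have "L2_set (x i) {1..D} powr q \<le> (\<Sum>i=1..r. L2_set (x i) {1..D} powr q)"
    using assms by (intro member_le_sum) auto
  then have "(L2_set (x i) {1..D} powr q) powr (1/q) \<le> (\<Sum>i=1..r. L2_set (x i) {1..D} powr q) powr (1/q)"
    using q by (intro powr_mono2) auto
  then show ?thesis
    using q real by (simp add: lp_l2_norm_def powr_powr L2_set_nonneg)
qed (use assms in \<open>auto simp: lp_l2_norm_def\<close>)

lemma lp_l2_norm_le:
  assumes "2 < p" "1 \<le> r" "\<And>i. i \<in> {1..r} \<Longrightarrow> L2_set (x i) {1..D} \<le> a"
  shows "lp_l2_norm p r D x \<le> real r powr real_of_ereal (1 / p) * a"
proof -
  have a: "a \<ge> 0"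
    using order_trans[OF L2_set_nonneg assms(3)[of 1]] assms(2) by auto
  show ?thesis
  proof (cases p)
    case (real q)
    with assms have q: "q > 2" by simp
    have "(\<Sum>i=1..r. L2_set (x i) {1..D} powr q) \<le> (\<Sum>i=1..r. a powr q)"
      using assms q by (intro sum_mono powr_mono2 L2_set_nonneg) auto
    then have "(\<Sum>i=1..r. L2_set (x i) {1..D} powr q) powr (1/q) \<le> (r * a powr q) powr (1/q)"
      using q by (intro powr_mono2) (auto intro: sum_nonneg)
    moreover have "1 / p = ereal (1 / q)" using q real by (simp add: one_ereal_def)
    ultimately show ?thesis
      using q real a by (simp add: lp_l2_norm_def powr_powr powr_mult)
  \<comment> \<open>Since \<open>2 < p\<close> excludes \<open>-\<infinity>\<close>, what remains is
    \<open>p = \<infinity>\<close>: there \<open>real_of_ereal (1 / p)\<close> is 0, so the factor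
    in front of \<open>a\<close> is 1.\<close>
  qed (use assms a in \<open>auto simp: lp_l2_norm_def\<close>)
qed

lemma lp_l2_norm_eq:
  assumes "2 < p" "1 \<le> r" "\<And>i. i \<in> {1..r} \<Longrightarrow> L2_set (x i) {1..D} = a"
  shows "lp_l2_norm p r D x = real r powr real_of_ereal (1 / p) * a"
proof -
  have a: "a \<ge> 0"
    using L2_set_nonneg assms(3)[of 1] assms(2) by (metis atLeastAtMost_iff order_refl)
  show ?thesis
  proof (cases p)
    case (real q)
    with assms have q: "q > 2" by simp
    have "1 / p = ereal (1 / q)" using q real by (simp add: one_ereal_def)
    then show ?thesis
      using q real a assms(3) by (simp add: lp_l2_norm_def powr_powr powr_mult)
  qed (use assms a in \<open>auto simp: lp_l2_norm_def\<close>)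
qed

section \<open>The set T: cardinality, norm and diameter\<close>

definition selection :: "nat \<Rightarrow> (nat \<Rightarrow> nat) \<Rightarrow> nat \<Rightarrow> nat \<Rightarrow> real" where
  "selection r s = (\<Sum>i=1..r. unit_vec i (s i))"

lemma selection_apply: "selection r s i t = (if i \<in> {1..r} \<and> t = s i then 1 else 0)"
proof -
  have "selection r s i t = (\<Sum>j=1..r. if j = i then if t = s i then 1 else 0 else 0)"
    unfolding selection_def sum_fun_apply by (intro sum.cong) (auto simp: unit_vec_def)
  then show ?thesis by (auto simp: sum.delta)
qed

text \<open>Only the values of \<open>s\<close> on \<open>{1..r}\<close> enter
  \<open>selection r s\<close>, so \<open>s\<close> may be restricted to an extensional function.
  This makes T a finite image, and an injective one when r is positive.\<close>

lemma T_set_eq: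
  "T_set p r D = (\<lambda>s. real r powr (- real_of_ereal (1 / p)) *\<^sub>R selection r s) ` ({1..r} \<rightarrow>\<^sub>E {1..D})"
proof -
  have "real r powr (- real_of_ereal (1 / p)) *\<^sub>R selection r s \<in>
      (\<lambda>s. real r powr (- real_of_ereal (1 / p)) *\<^sub>R selection r s) ` ({1..r} \<rightarrow>\<^sub>E {1..D})"
    if "\<forall>i\<in>{1..r}. s i \<in> {1..D}" for s
  proof (rule image_eqI)
    show "real r powr (- real_of_ereal (1 / p)) *\<^sub>R selection r s =
        real r powr (- real_of_ereal (1 / p)) *\<^sub>R selection r (restrict s {1..r})"
      by (intro ext) (simp add: selection_apply)
  qed (use that in auto)
  then show ?thesis
    unfolding T_set_def selection_def[symmetric] by blast
qed

lemma finite_T_set: "finite (T_set p r D)"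
  unfolding T_set_eq by (intro finite_imageI finite_PiE) auto

lemma card_T_set:
  assumes "1 \<le> r"
  shows "card (T_set p r D) = D ^ r"
proof -
  have "inj_on (\<lambda>s. real r powr (- real_of_ereal (1 / p)) *\<^sub>R selection r s) ({1..r} \<rightarrow>\<^sub>E {1..D})"
  proof (rule inj_onI)
    fix s t assume *: "s \<in> {1..r} \<rightarrow>\<^sub>E {1..D}" "t \<in> {1..r} \<rightarrow>\<^sub>E {1..D}"
      "real r powr (- real_of_ereal (1 / p)) *\<^sub>R selection r s = real r powr (- real_of_ereal (1 / p)) *\<^sub>R selection r t"
    then have "selection r s = selection r t" using assms by simp
    \<comment> \<open>Coordinate \<open>s i\<close> of block \<open>i\<close> is 1 on the left,
      hence on the right too, and that happens only at \<open>t i\<close>.\<close>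
    then have "s i = t i" if "i \<in> {1..r}" for i
      using that selection_apply[of r s i "s i"] selection_apply[of r t i "s i"]
      by (simp split: if_splits)
    with * show "s = t" by (intro PiE_ext) auto
  qed
  then show ?thesis unfolding T_set_eq by (simp add: card_image card_PiE)
qed

lemma L2_set_block_T_set:
  assumes "x \<in> T_set p r D" "i \<in> {1..r}"
  shows "L2_set (x i) {1..D} = real r powr (- real_of_ereal (1 / p))"
proof -
  from assms obtain s where s: "s \<in> {1..r} \<rightarrow>\<^sub>E {1..D}"
    "x = real r powr (- real_of_ereal (1 / p)) *\<^sub>R selection r s" by (auto simp: T_set_eq)
  then have "s i \<in> {1..D}" using assms by auto
  then show ?thesis
    using assms unfolding L2_set_def s(2)
    by (simp add: selection_apply if_distrib power_mult_distrib if_distribR cong: if_cong)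
qed

lemma T_set_subset_sphere:
  assumes "2 < p" "1 \<le> r"
  shows "T_set p r D \<subseteq> {x \<in> lp_l2_space r D. lp_l2_norm p r D x = 1}"
proof safe
  fix x assume x: "x \<in> T_set p r D"
  show "lp_l2_norm p r D x = 1"
    using lp_l2_norm_eq[OF assms L2_set_block_T_set[OF x]] assms
    by (simp add: powr_minus field_simps)
  show "x \<in> lp_l2_space r D"
    using x by (auto simp: T_set_eq lp_l2_space_def selection_apply PiE_def Pi_def)
qed

lemma L2_set_diff_le: "L2_set (\<lambda>s. f s - g s) A \<le> L2_set f A + L2_set g A"
  using L2_set_triangle_ineq[of f "\<lambda>s. - g s" A] by (simp add: L2_set_def)

text \<open>The Euclidean triangle inequality is applied within each block, so none is needed for
  the mixed norm.\<close>

lemma T_set_dist_le: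
  assumes "2 < p" "1 \<le> r" "x \<in> T_set p r D" "y \<in> T_set p r D"
  shows "lp_l2_norm p r D (x - y) \<le> 2"
proof -
  have "lp_l2_norm p r D (x - y) \<le>
      real r powr real_of_ereal (1 / p) * (2 * real r powr (- real_of_ereal (1 / p)))"
  proof (rule lp_l2_norm_le[OF assms(1,2)])
    fix i assume i: "i \<in> {1..r}"
    have "L2_set (x i - y i) {1..D} \<le> L2_set (x i) {1..D} + L2_set (y i) {1..D}"
      using L2_set_diff_le[of "x i" "y i" "{1..D}"] by (simp add: fun_diff_def)
    then show "L2_set ((x - y) i) {1..D} \<le> 2 * real r powr (- real_of_ereal (1 / p))"
      using i assms L2_set_block_T_set by simp
  qed
  also have "\<dots> = 2" using assms by (simp add: powr_minus field_simps)
  finally show ?thesis .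
qed

lemma lp_l2_norm_zero:
  assumes "2 < p" "1 \<le> r"
  shows "lp_l2_norm p r D 0 = 0"
  using lp_l2_norm_eq[OF assms, of 0 D 0] by (simp add: L2_set_def)

section \<open>Cells, diameters and upper bounds for \<open>gamma2\<close>\<close>

lemma part_of_eqI:
  assumes "partition_on K P" "A \<in> P" "x \<in> A"
  shows "part_of P x = A"
  unfolding part_of_def using assms
  by (intro the_equality) (auto simp: partition_on_def disjoint_def)

lemma part_of_mem:
  assumes "partition_on K P" "x \<in> K"
  shows "part_of P x \<in> P" "x \<in> part_of P x"
proof -
  obtain A where "A \<in> P" "x \<in> A" using assms by (auto simp: partition_on_def)
  with part_of_eqI[OF assms(1)] show "part_of P x \<in> P" "x \<in> part_of P x" by auto
qed

lemma ediam_ge: "x \<in> A \<Longrightarrow> y \<in> A \<Longrightarrow> ennreal (d x y) \<le> ediam d A"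
  unfolding ediam_def by (intro SUP_upper2[of x] SUP_upper2[of y]) auto

lemma ediam_le:
  assumes "\<And>x y. x \<in> A \<Longrightarrow> y \<in> A \<Longrightarrow> d x y \<le> b"
  shows "ediam d A \<le> ennreal b"
  unfolding ediam_def by (intro SUP_least ennreal_leI assms)

lemma sum_powr_half_le: "(\<Sum>n<m. 2 powr (real n / 2)) \<le> 3 * 2 powr (real m / 2)"
proof (induction m)
  case (Suc m)
  \<comment> \<open>The induction step adds one term to three and must fit into the growth factor
    \<open>sqrt 2\<close>: the constant 3 satisfies 3 + 1 \<le> 3 * \<open>sqrt 2\<close>.\<close>
  have "(4::real) \<le> 3 * sqrt 2"
    by (rule power2_le_imp_le) (auto simp: power_mult_distrib)
  then have "4 * 2 powr (real m / 2) \<le> 3 * sqrt 2 * 2 powr (real m / 2)"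
    by (rule mult_right_mono) simp
  also have "\<dots> = 3 * (sqrt 2 * 2 powr (real m / 2))" by (simp only: mult.assoc)
  also have "sqrt 2 * 2 powr (real m / 2) = 2 powr (real (Suc m) / 2)"
    unfolding powr_half_sqrt[symmetric, OF zero_le_numeral] powr_add[symmetric]
    by (simp add: add_divide_distrib)
  finally show ?case using Suc by simp
qed auto

lemma gamma2_finite_le:
  assumes "finite K" "K \<noteq> {}" "card K \<le> 2 ^ 2 ^ m" "1 \<le> m" "0 \<le> b"
    and diag: "\<And>x. x \<in> K \<Longrightarrow> d x x = 0" and bound: "\<And>x y. x \<in> K \<Longrightarrow> y \<in> K \<Longrightarrow> d x y \<le> b"
  shows "gamma2 K d \<le> ennreal (3 * b * 2 powr (real m / 2))"
proof -
  \<comment> \<open>The hypothesis \<open>1 \<le> m\<close> makes level 0 the trivial partition, as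
    admissibility demands.\<close>
  define \<A> where "\<A> n = (if n < m then {K} else (\<lambda>x. {x}) ` K)" for n
  have part: "partition_on K (\<A> n)" for n
    using assms by (simp add: \<A>_def partition_on_space partition_on_singletons)
  have "card (\<A> n) \<le> 2 ^ 2 ^ n" for n
  proof (cases "n < m")
    case False
    then have "(2::nat) ^ 2 ^ m \<le> 2 ^ 2 ^ n" by (intro power_increasing) auto
    moreover have "card ((\<lambda>x. {x}) ` K) = card K" by (intro card_image) auto
    ultimately show ?thesis using False assms(3) by (auto simp: \<A>_def intro: order_trans)
  qed (simp add: \<A>_def)
  then have adm: "admissible K \<A>"
    using part assms unfolding admissible_def refines_def by (auto simp: \<A>_def)
  have "(\<Sum>n. ennreal (2 powr (real n / 2)) * ediam d (part_of (\<A> n) x))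
      \<le> ennreal (3 * b * 2 powr (real m / 2))" if x: "x \<in> K" for x
  proof -
    have "part_of (\<A> n) x = (if n < m then K else {x})" for n
      using x by (intro part_of_eqI[OF part]) (auto simp: \<A>_def)
    then have zero: "ediam d (part_of (\<A> n) x) = 0" if "n \<notin> {..<m}" for n
      using that x diag by (simp add: ediam_def)
    have le: "ediam d (part_of (\<A> n) x) \<le> ennreal b" for n
      using \<open>part_of (\<A> n) x = _\<close> bound x by (intro ediam_le) (auto split: if_splits)
    have "(\<Sum>n. ennreal (2 powr (real n / 2)) * ediam d (part_of (\<A> n) x)) =
        (\<Sum>n<m. ennreal (2 powr (real n / 2)) * ediam d (part_of (\<A> n) x))"
      by (intro suminf_finite) (use zero in auto)
    also have "\<dots> \<le> (\<Sum>n<m. ennreal (2 powr (real n / 2)) * ennreal b)"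
      by (intro sum_mono mult_left_mono le) auto
    also have "\<dots> = ennreal ((\<Sum>n<m. 2 powr (real n / 2)) * b)"
      using assms by (simp add: sum_distrib_right ennreal_mult[symmetric] flip: sum_ennreal)
    also have "\<dots> \<le> ennreal (3 * 2 powr (real m / 2) * b)"
      using assms by (intro ennreal_leI mult_right_mono sum_powr_half_le)
    finally show ?thesis by (simp add: mult_ac)
  qed
  with adm show ?thesis unfolding gamma2_def by (intro INF_lower2[of \<A>] SUP_least) auto
qed

lemma ex_power_two_between:
  assumes "1 \<le> (r::nat)"
  obtains k where "2 ^ k \<le> r" "r < 2 ^ Suc k"
  using ex_power_ivl1[of 2 r] assms by auto

lemma gamma2_T_set_le:
  assumes "2 < p" "1 \<le> r"
  shows "gamma2_norm (T_set p r (2 ^ (128 * r))) (lp_l2_norm p r (2 ^ (128 * r))) \<le> ennreal (144 * real r)"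
proof -
  obtain k where k: "2 ^ k \<le> r" "r < 2 ^ Suc k" using ex_power_two_between[OF assms(2)] .
  \<comment> \<open>Here \<open>2 ^ m\<close> is 128 times the square of \<open>2 ^ Suc k\<close>,
    hence at least \<open>128 * r * r\<close>, the binary logarithm of the cardinality of T.\<close>
  define m where "m = 2 * (k + 1) + 7"
  have "128 * r * r \<le> 128 * (2 ^ Suc k) * 2 ^ Suc k"
    using k by (intro mult_mono) auto
  also have "\<dots> = 2 ^ m" by (simp add: m_def power_add power_even_eq power2_eq_square)
  finally have "card (T_set p r (2 ^ (128 * r))) \<le> 2 ^ 2 ^ m"
    using assms by (simp add: card_T_set power_mult[symmetric])
  moreover have "T_set p r (2 ^ (128 * r)) \<noteq> {}"
    by (auto simp: T_set_eq PiE_eq_empty_iff)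
  ultimately have "gamma2_norm (T_set p r (2 ^ (128 * r))) (lp_l2_norm p r (2 ^ (128 * r)))
      \<le> ennreal (3 * 2 * 2 powr (real m / 2))"
    unfolding gamma2_norm_def using assms
    by (intro gamma2_finite_le finite_T_set) (auto simp: m_def lp_l2_norm_zero T_set_dist_le)
  also have "3 * 2 * 2 powr (real m / 2) \<le> 144 * real r"
  proof (rule power2_le_imp_le)
    have "(2 powr (real m / 2))\<^sup>2 = 2 ^ m"
      by (simp add: power2_eq_square powr_add[symmetric] powr_realpow)
    also have "\<dots> = 512 * (2 ^ k)\<^sup>2"
      by (simp add: m_def power_add power_even_eq)
    also have "\<dots> \<le> 512 * (real r)\<^sup>2"
      using k(1) by (intro mult_left_mono power_mono) (auto simp flip: of_nat_le_iff)
    \<comment> \<open>Rounding 512 up to the square of 24 gives a rational constant: 6 * 24 =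
      144.\<close>
    also have "\<dots> \<le> 576 * (real r)\<^sup>2" by simp
    finally show "(3 * 2 * 2 powr (real m / 2))\<^sup>2 \<le> (144 * real r)\<^sup>2"
      by (simp add: power_mult_distrib)
  qed simp
  finally show ?thesis by (simp add: ennreal_leI)
qed

section \<open>Counting: Hamming balls and the union bound\<close>

text \<open>Choose the set \<open>V\<close> of disagreement, in at most \<open>2 ^ card I\<close>
  ways; then \<open>g\<close> is free on \<open>V\<close> and equal to \<open>f\<close>
  elsewhere.\<close>

lemma card_hamming_ball_le:
  assumes "finite I" "finite Q" "Q \<noteq> {}"
  shows "card {g \<in> I \<rightarrow>\<^sub>E Q. card {b \<in> I. f b \<noteq> g b} \<le> h} \<le> 2 ^ card I * card Q ^ h"
proof -
  let ?V = "{V. V \<subseteq> I \<and> card V \<le> h}"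
  let ?P = "\<lambda>V. \<Pi>\<^sub>E b\<in>I. if b \<in> V then Q else {f b}"
  have fin: "finite ?V" using assms by simp
  have card_P: "card (?P V) \<le> card Q ^ h" if "V \<in> ?V" for V
  proof -
    have "card (?P V) = (\<Prod>b\<in>I. if b \<in> V then card Q else 1)"
      using assms by (simp add: card_PiE) (intro prod.cong, auto)
    also have "\<dots> = card Q ^ card V"
      using that assms by (simp add: prod.If_cases Int_absorb1)
    also have "\<dots> \<le> card Q ^ h"
      using that assms by (intro power_increasing) (auto simp: Suc_le_eq card_gt_0_iff)
    finally show ?thesis .
  qed
  have "{g \<in> I \<rightarrow>\<^sub>E Q. card {b \<in> I. f b \<noteq> g b} \<le> h} \<subseteq> (\<Union>V\<in>?V. ?P V)"
  proof
    fix g assume "g \<in> {g \<in> I \<rightarrow>\<^sub>E Q. card {b \<in> I. f b \<noteq> g b} \<le> h}"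
    then show "g \<in> (\<Union>V\<in>?V. ?P V)"
      by (intro UN_I[of "{b \<in> I. f b \<noteq> g b}"]) (auto simp: PiE_def Pi_def)
  qed
  then have "card {g \<in> I \<rightarrow>\<^sub>E Q. card {b \<in> I. f b \<noteq> g b} \<le> h} \<le> card (\<Union>V\<in>?V. ?P V)"
    using assms fin by (intro card_mono finite_UN_I finite_PiE) auto
  also have "\<dots> \<le> (\<Sum>V\<in>?V. card (?P V))" by (rule card_UN_le[OF fin])
  also have "\<dots> \<le> (\<Sum>V\<in>?V. card Q ^ h)" by (rule sum_mono[OF card_P])
  also have "\<dots> = card ?V * card Q ^ h" by simp
  also have "\<dots> \<le> card (Pow I) * card Q ^ h"
    using assms by (intro mult_right_mono card_mono) auto
  finally show ?thesis using assms by (simp add: card_Pow)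
qed

text \<open>Call \<open>F\<close> crowded at \<open>i\<close> if all points with its label are
  \<open>R\<close>-close to it in coordinate \<open>i\<close>. Fix one crowded point of a class:
  every other one has its coordinate \<open>i\<close> among at most \<open>\<beta>\<close> values,
  the other coordinates being free. Summing over labels gives the bound, multiplied by
  \<open>card (X i)\<close> to avoid a quotient.\<close>

lemma card_crowded_le:
  fixes X :: "'i \<Rightarrow> 'a set"
  assumes "finite I" "i \<in> I" and fin: "\<And>j. j \<in> I \<Longrightarrow> finite (X j)"
    and "finite L" and l: "\<And>F. F \<in> Pi\<^sub>E I X \<Longrightarrow> l F \<in> L"
    and R: "\<And>f. f \<in> X i \<Longrightarrow> card {g \<in> X i. R f g} \<le> \<beta>"
  shows "card {F \<in> Pi\<^sub>E I X. \<forall>G\<in>Pi\<^sub>E I X. l G = l F \<longrightarrow> R (F i) (G i)} * card (X i)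
    \<le> card L * \<beta> * card (Pi\<^sub>E I X)"
proof -
  let ?B = "{F \<in> Pi\<^sub>E I X. \<forall>G\<in>Pi\<^sub>E I X. l G = l F \<longrightarrow> R (F i) (G i)}"
  let ?rest = "\<Prod>j\<in>I - {i}. card (X j)"
  have class_le: "card {F \<in> ?B. l F = a} \<le> \<beta> * ?rest" for a
  proof (cases "{F \<in> ?B. l F = a} = {}")
    case False
    then obtain F where F: "F \<in> ?B" "l F = a" by blast
    let ?X = "X(i := {g \<in> X i. R (F i) g})"
    have "{F \<in> ?B. l F = a} \<subseteq> Pi\<^sub>E I ?X"
    proof
      fix G assume "G \<in> {F \<in> ?B. l F = a}"
      then have "G \<in> Pi\<^sub>E I X" "R (F i) (G i)" using F by auto
      then show "G \<in> Pi\<^sub>E I ?X" using \<open>i \<in> I\<close> by (auto simp: PiE_def Pi_def)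
    qed
    then have "card {F \<in> ?B. l F = a} \<le> card (Pi\<^sub>E I ?X)"
      using assms(1) fin by (intro card_mono finite_PiE) auto
    also have "\<dots> = card {g \<in> X i. R (F i) g} * (\<Prod>j\<in>I - {i}. card (?X j))"
      unfolding card_PiE[OF assms(1)] prod.remove[OF assms(1,2)] by simp
    also have "(\<Prod>j\<in>I - {i}. card (?X j)) = ?rest" by (intro prod.cong) auto
    also have "card {g \<in> X i. R (F i) g} * ?rest \<le> \<beta> * ?rest"
      using F(1) \<open>i \<in> I\<close> by (intro mult_right_mono R) auto
    finally show ?thesis .
  next
    case True
    show ?thesis unfolding True by simp
  qed
  have "?B = (\<Union>a\<in>L. {F \<in> ?B. l F = a})" using l by auto
  then have "card ?B = card (\<Union>a\<in>L. {F \<in> ?B. l F = a})" by (rule arg_cong)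
  also have "\<dots> \<le> (\<Sum>a\<in>L. card {F \<in> ?B. l F = a})" by (rule card_UN_le[OF \<open>finite L\<close>])
  also have "\<dots> \<le> (\<Sum>a\<in>L. \<beta> * ?rest)" by (rule sum_mono[OF class_le])
  finally have "card ?B * card (X i) \<le> (card L * (\<beta> * ?rest)) * card (X i)"
    by (intro mult_right_mono) auto
  also have "\<dots> = card L * \<beta> * card (Pi\<^sub>E I X)"
    unfolding card_PiE[OF assms(1)] prod.remove[OF assms(1,2)] by (simp add: mult_ac)
  finally show ?thesis .
qed

text \<open>By \<open>card_crowded_le\<close> the proportion of points crowded at \<open>i\<close>
  is at most \<open>w i\<close>. These proportions add up to less than 1, so some point is crowded
  at no \<open>i\<close>.\<close>

lemma ex_uncrowded:
  fixes X :: "'i \<Rightarrow> 'a set" and w :: "'i \<Rightarrow> real"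
  assumes "finite I" and X: "\<And>i. i \<in> I \<Longrightarrow> finite (X i)" "\<And>i. i \<in> I \<Longrightarrow> X i \<noteq> {}"
    and L: "\<And>i. i \<in> I \<Longrightarrow> finite (L i)" "\<And>i F. i \<in> I \<Longrightarrow> F \<in> Pi\<^sub>E I X \<Longrightarrow> l i F \<in> L i"
    and R: "\<And>i f. i \<in> I \<Longrightarrow> f \<in> X i \<Longrightarrow> card {g \<in> X i. R i f g} \<le> \<beta> i"
    and w: "\<And>i. i \<in> I \<Longrightarrow> real (card (L i) * \<beta> i) \<le> w i * card (X i)" "sum w I < 1"
  obtains F where "F \<in> Pi\<^sub>E I X"
    "\<And>i. i \<in> I \<Longrightarrow> \<exists>G\<in>Pi\<^sub>E I X. l i G = l i F \<and> \<not> R i (F i) (G i)"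
proof -
  let ?B = "\<lambda>i. {F \<in> Pi\<^sub>E I X. \<forall>G\<in>Pi\<^sub>E I X. l i G = l i F \<longrightarrow> R i (F i) (G i)}"
  have fin: "finite (Pi\<^sub>E I X)" using assms by (intro finite_PiE) auto
  have "Pi\<^sub>E I X \<noteq> {}" using X by (auto simp: PiE_eq_empty_iff)
  with fin have pos: "0 < real (card (Pi\<^sub>E I X))" by (simp add: card_gt_0_iff)
  have B_le: "real (card (?B i)) \<le> w i * card (Pi\<^sub>E I X)" if i: "i \<in> I" for i
  proof -
    have "card (?B i) * card (X i) \<le> card (L i) * \<beta> i * card (Pi\<^sub>E I X)"
      using i by (intro card_crowded_le assms(1) X L R)
    then have "real (card (?B i)) * card (X i) \<le> real (card (L i) * \<beta> i) * card (Pi\<^sub>E I X)"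
      unfolding of_nat_mult[symmetric] of_nat_le_iff .
    also have "\<dots> \<le> w i * card (X i) * card (Pi\<^sub>E I X)"
      using w(1)[OF i] by (intro mult_right_mono) auto
    finally have "real (card (?B i)) * card (X i) \<le> (w i * card (Pi\<^sub>E I X)) * card (X i)"
      by (simp add: mult_ac)
    moreover have "0 < real (card (X i))" using X i by (simp add: card_gt_0_iff)
    ultimately show ?thesis by (simp only: mult_le_cancel_right_pos)
  qed
  have "real (card (\<Union>i\<in>I. ?B i)) \<le> (\<Sum>i\<in>I. real (card (?B i)))"
    unfolding of_nat_sum[symmetric] of_nat_le_iff by (rule card_UN_le[OF \<open>finite I\<close>])
  also have "\<dots> \<le> (\<Sum>i\<in>I. w i * card (Pi\<^sub>E I X))" by (rule sum_mono[OF B_le])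
  also have "\<dots> < card (Pi\<^sub>E I X)"
    using mult_strict_right_mono[OF w(2) pos] by (simp add: sum_distrib_right)
  finally have "card (\<Union>i\<in>I. ?B i) < card (Pi\<^sub>E I X)" by simp
  moreover have "finite (\<Union>i\<in>I. ?B i)"
    by (intro finite_UN_I \<open>finite I\<close> finite_subset[OF _ fin]) blast
  ultimately have "\<not> Pi\<^sub>E I X \<subseteq> (\<Union>i\<in>I. ?B i)"
    using card_mono[of "\<Union>i\<in>I. ?B i" "Pi\<^sub>E I X"] by linarith
  then obtain F where "F \<in> Pi\<^sub>E I X" "F \<notin> (\<Union>i\<in>I. ?B i)" by blast
  show thesis
  proof (rule that[OF \<open>F \<in> Pi\<^sub>E I X\<close>])
    fix i assume "i \<in> I"
    with \<open>F \<in> Pi\<^sub>E I X\<close> \<open>F \<notin> (\<Union>i\<in>I. ?B i)\<close>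
    show "\<exists>G\<in>Pi\<^sub>E I X. l i G = l i F \<and> \<not> R i (F i) (G i)" by blast
  qed
qed

section \<open>Averages of unit vectors within one block\<close>

text \<open>In block \<open>i\<close>, the first \<open>2 ^ i * q\<close> coordinates are cut into \<open>2 ^ i\<close> intervals of length
  \<open>q\<close>; \<open>f\<close> selects one coordinate in each.\<close>

definition spread :: "nat \<Rightarrow> nat \<Rightarrow> (nat \<Rightarrow> nat) \<Rightarrow> nat \<Rightarrow> nat \<Rightarrow> real" where
  "spread i q f = (\<Sum>b<2 ^ i. (1 / 2 ^ i) *\<^sub>R unit_vec i (b * q + f b + 1))"

lemma cell_index_le:
  assumes "b < m" "c < (q::nat)"
  shows "b * q + c + 1 \<le> m * q"
proof -
  have "b * q + c + 1 \<le> (b + 1) * q" using assms by simp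
  also have "\<dots> \<le> m * q" using assms by (intro mult_right_mono) auto
  finally show ?thesis .
qed

text \<open>Uniqueness of quotient and remainder: different intervals share no coordinate.\<close>

lemma cell_index_eq_iff:
  assumes "c < q" "c' < (q::nat)"
  shows "b * q + c = b' * q + c' \<longleftrightarrow> b = b' \<and> c = c'"
proof
  assume eq: "b * q + c = b' * q + c'"
  have "(b * q + c) div q = b" "(b' * q + c') div q = b'" using assms by auto
  with eq show "b = b' \<and> c = c'" by simp
qed simp

lemma spread_other_block: "j \<noteq> i \<Longrightarrow> spread i q f j t = 0"
  by (simp add: spread_def sum_fun_apply unit_vec_def)

lemma spread_apply:
  assumes f: "f \<in> {..<2 ^ i} \<rightarrow> {..<q}" and "b < 2 ^ i" "c < q"
  shows "spread i q f i (b * q + c + 1) = (if f b = c then 1 / 2 ^ i else 0)"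
proof -
  have "spread i q f i (b * q + c + 1) =
      (\<Sum>b'<2 ^ i. if b' = b then if f b = c then 1 / 2 ^ i else 0 else 0)"
    unfolding spread_def sum_fun_apply
  proof (intro sum.cong refl)
    fix b' assume "b' \<in> {..<(2::nat) ^ i}"
    then have "b * q + c = b' * q + f b' \<longleftrightarrow> b = b' \<and> c = f b'"
      using f \<open>c < q\<close> by (intro cell_index_eq_iff) auto
    then show "((1 / 2 ^ i) *\<^sub>R unit_vec i (b' * q + f b' + 1)) i (b * q + c + 1) =
        (if b' = b then if f b = c then 1 / 2 ^ i else 0 else 0)"
      by (auto simp: unit_vec_def)
  qed
  then show ?thesis using \<open>b < 2 ^ i\<close> by simp
qed

lemma spread_mem_hull:
  assumes "f \<in> {..<2 ^ i} \<rightarrow> {..<q}" "2 ^ i * q = D"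
  shows "spread i q f \<in> convex hull (unit_vec i ` {1..D})"
  unfolding spread_def
proof (intro convex_sum)
  fix b assume "b \<in> {..<(2::nat) ^ i}"
  then have "b * q + f b + 1 \<le> D" using assms cell_index_le[of b "2 ^ i" "f b" q] by auto
  then show "unit_vec i (b * q + f b + 1) \<in> convex hull (unit_vec i ` {1..D})"
    by (intro hull_inc imageI) auto
qed auto

text \<open>In each interval where \<open>f\<close> and \<open>g\<close> differ, the coordinate
  chosen by \<open>f\<close> carries \<open>1 / 2 ^ i\<close> in one average and 0 in the other.
  These coordinates alone give the bound; dropping those chosen by \<open>g\<close> costs only a
  factor \<open>sqrt 2\<close>.\<close>

lemma spread_dist_ge:
  assumes f: "f \<in> {..<2 ^ i} \<rightarrow> {..<q}" and g: "g \<in> {..<2 ^ i} \<rightarrow> {..<q}" and "2 ^ i * q = D"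
  shows "sqrt (card {b \<in> {..<2 ^ i}. f b \<noteq> g b}) / 2 ^ i
    \<le> L2_set (\<lambda>t. spread i q f i t - spread i q g i t) {1..D}"
proof -
  let ?H = "{b \<in> {..<2 ^ i}. f b \<noteq> g b}" and ?ix = "\<lambda>b. b * q + f b + 1"
  let ?d = "\<lambda>t. (spread i q f i t - spread i q g i t)\<^sup>2"
  have inj: "inj_on ?ix ?H"
    using f by (intro inj_onI) (auto simp: cell_index_eq_iff Pi_def)
  have sub: "?ix ` ?H \<subseteq> {1..D}"
  proof (rule image_subsetI)
    fix b assume "b \<in> ?H"
    then have "b * q + f b + 1 \<le> D"
      using f cell_index_le[of b "2 ^ i" "f b" q] assms(3) by auto
    then show "?ix b \<in> {1..D}" by simp
  qed
  have "?d (?ix b) = (1 / 2 ^ i)\<^sup>2" if "b \<in> ?H" for b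
    using that f g spread_apply[OF f, of b "f b"] spread_apply[OF g, of b "f b"]
    by (auto simp: Pi_def)
  then have "(\<Sum>t\<in>?ix ` ?H. ?d t) = card ?H * (1 / 2 ^ i)\<^sup>2"
    unfolding sum.reindex[OF inj] by simp
  moreover have "(\<Sum>t\<in>?ix ` ?H. ?d t) \<le> (\<Sum>t=1..D. ?d t)"
    using sub by (intro sum_mono2) auto
  ultimately have "sqrt (card ?H * (1 / 2 ^ i)\<^sup>2) \<le> L2_set (\<lambda>t. spread i q f i t - spread i q g i t) {1..D}"
    unfolding L2_set_def by simp
  then show ?thesis by (simp add: real_sqrt_mult real_sqrt_divide)
qed

section \<open>Points of conv T built from one average per block\<close>

definition code_point :: "ereal \<Rightarrow> nat \<Rightarrow> (nat \<Rightarrow> nat) \<Rightarrow> (nat \<Rightarrow> nat \<Rightarrow> nat) \<Rightarrow> nat \<Rightarrow> nat \<Rightarrow> real" where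
  "code_point p r q F = real r powr (- real_of_ereal (1 / p)) *\<^sub>R (\<Sum>i=1..r. spread i (q i) (F i))"

lemma code_point_apply:
  assumes "i \<in> {1..r}"
  shows "code_point p r q F i t = real r powr (- real_of_ereal (1 / p)) * spread i (q i) (F i) i t"
proof -
  have "(\<Sum>j=1..r. spread j (q j) (F j)) i t = (\<Sum>j\<in>{i}. spread j (q j) (F j) i t)"
    unfolding sum_fun_apply using assms
    by (intro sum.mono_neutral_right) (auto simp: spread_other_block)
  then show ?thesis by (simp add: code_point_def)
qed

text \<open>The sum is a Minkowski sum of sets: an element picks one unit vector in every
  block.\<close>

lemma scaled_sum_unit_vec_subset_T_set:
  "(*\<^sub>R) (real r powr (- real_of_ereal (1 / p))) ` (\<Sum>i=1..r. unit_vec i ` {1..D}) \<subseteq> T_set p r D"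
proof (rule image_subsetI)
  fix x assume "x \<in> (\<Sum>i=1..r. unit_vec i ` {1..D})"
  then obtain v where v: "x = sum v {1..r}" "\<forall>i\<in>{1..r}. v i \<in> unit_vec i ` {1..D}"
    unfolding set_sum_alt[OF finite_atLeastAtMost] by blast
  then have "\<forall>i\<in>{1..r}. \<exists>s. s \<in> {1..D} \<and> v i = unit_vec i s" by blast
  from bchoice[OF this]
  obtain s where s: "\<forall>i\<in>{1..r}. s i \<in> {1..D} \<and> v i = unit_vec i (s i)" ..
  then have "x = (\<Sum>i=1..r. unit_vec i (s i))"
    unfolding v(1) by (intro sum.cong) auto
  with s show "real r powr (- real_of_ereal (1 / p)) *\<^sub>R x \<in> T_set p r D"
    unfolding T_set_def by (intro CollectI exI[of _ s] conjI ballI) auto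
qed

text \<open>Convex hulls commute with Minkowski sums and with scaling, so it suffices that each
  average lies in the hull of the unit vectors of its own block.\<close>

lemma code_point_mem_hull:
  assumes "\<And>i. i \<in> {1..r} \<Longrightarrow> F i \<in> {..<2 ^ i} \<rightarrow> {..<q i}" "\<And>i. i \<in> {1..r} \<Longrightarrow> 2 ^ i * q i = D"
  shows "code_point p r q F \<in> convex hull T_set p r D"
proof -
  have "(\<Sum>i=1..r. spread i (q i) (F i)) \<in> (\<Sum>i=1..r. convex hull (unit_vec i ` {1..D}))"
    unfolding set_sum_alt[OF finite_atLeastAtMost]
    using spread_mem_hull assms by (intro CollectI exI[of _ "\<lambda>i. spread i (q i) (F i)"] conjI refl ballI) auto
  then have "code_point p r q F \<in>
      convex hull ((*\<^sub>R) (real r powr (- real_of_ereal (1 / p))) ` (\<Sum>i=1..r. unit_vec i ` {1..D}))"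
    unfolding convex_hull_scaling convex_hull_set_sum code_point_def by blast
  then show ?thesis using hull_mono[OF scaled_sum_unit_vec_subset_T_set] by blast
qed

lemma code_point_dist_ge:
  assumes "2 < p" "i \<in> {1..r}"
    and "F i \<in> {..<2 ^ i} \<rightarrow> {..<q i}" "G i \<in> {..<2 ^ i} \<rightarrow> {..<q i}" "2 ^ i * q i = D"
  shows "real r powr (- real_of_ereal (1 / p)) * (sqrt (card {b \<in> {..<2 ^ i}. F i b \<noteq> G i b}) / 2 ^ i)
    \<le> lp_l2_norm p r D (code_point p r q F - code_point p r q G)"
proof -
  let ?c = "real r powr (- real_of_ereal (1 / p))"
  have "?c * (sqrt (card {b \<in> {..<2 ^ i}. F i b \<noteq> G i b}) / 2 ^ i)
      \<le> ?c * L2_set (\<lambda>t. spread i (q i) (F i) i t - spread i (q i) (G i) i t) {1..D}"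
    using assms by (intro mult_left_mono spread_dist_ge) auto
  also have "\<dots> = L2_set ((code_point p r q F - code_point p r q G) i) {1..D}"
    unfolding L2_set_right_distrib[OF powr_ge_zero]
    using assms by (intro L2_set_cong) (auto simp: code_point_apply right_diff_distrib)
  also have "\<dots> \<le> lp_l2_norm p r D (code_point p r q F - code_point p r q G)"
    by (rule lp_l2_norm_ge_block[OF assms(1,2)])
  finally show ?thesis .
qed

section \<open>Numerical estimates for the scales\<close>

lemma sum_half_powers_less: "(\<Sum>i=1..r. (1/2) ^ i) < (1::real)"
proof -
  have "(\<Sum>i=1..r. (1/2) ^ i) = 1 - (1/2::real) ^ r" by (induction r) auto
  then show ?thesis by simp
qed

text \<open>With \<open>i = Suc j\<close>, the left side collects the binary logarithms of the
  number of cells at level \<open>i + k\<close>, of the factor \<open>2 ^ 2 ^ i\<close> of a Hamming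
  ball, and of the reciprocal weight \<open>2 ^ i\<close>. The right side is the logarithm of
  \<open>q i ^ 2 ^ j\<close>, what remains of \<open>card (X i)\<close> after dividing by the other
  ball factor.\<close>

lemma ball_volume_exponent_le:
  fixes j k r :: nat
  assumes "Suc j \<le> r" "2 ^ k \<le> r"
  shows "2 ^ (Suc j + k) + 2 ^ Suc j + Suc j \<le> (128 * r - Suc j) * 2 ^ j"
proof -
  have "(2::nat) ^ (Suc j + k) = 2 * 2 ^ j * 2 ^ k" by (simp add: power_add)
  also have "\<dots> \<le> 2 * 2 ^ j * r" using assms by (intro mult_left_mono) auto
  finally have "(2::nat) ^ (Suc j + k) + 2 ^ Suc j + Suc j \<le> 2 * 2 ^ j * r + 2 ^ Suc j + 2 ^ Suc j"
    using less_exp[of "Suc j"] by linarith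
  also have "\<dots> = (2 * r + 4) * 2 ^ j" by (simp add: algebra_simps)
  \<comment> \<open>As \<open>Suc j \<le> r\<close>, the factor on the right is at least
    \<open>127 * r\<close>, which exceeds \<open>2 * r + 4\<close>.\<close>
  also have "\<dots> \<le> (128 * r - Suc j) * 2 ^ j" using assms by (intro mult_right_mono) auto
  finally show ?thesis .
qed

text \<open>The growth of the weight in \<open>j\<close> exactly cancels the decay of the
  separation, leaving \<open>sqrt (2 ^ Suc k) / 2\<close> at every scale.\<close>

lemma scale_contribution_ge:
  assumes "real r \<le> 2 ^ Suc k"
  shows "sqrt r / 2 \<le> 2 powr (real (Suc j + k) / 2) * (sqrt (2 ^ j) / 2 ^ Suc j)"
proof -
  have "2 powr (real (Suc j + k) / 2) = (2 powr real (Suc j + k)) powr (1 / 2)"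
    by (simp only: powr_powr) simp
  also have "\<dots> = sqrt (2 ^ (Suc j + k))"
    by (subst powr_realpow) (simp_all add: powr_half_sqrt)
  also have "\<dots> = sqrt (2 ^ j * 2 ^ Suc k)" by (simp add: power_add)
  also have "\<dots> = sqrt (2 ^ j) * sqrt (2 ^ Suc k)" by (rule real_sqrt_mult)
  finally have "2 powr (real (Suc j + k) / 2) * (sqrt (2 ^ j) / 2 ^ Suc j) =
      (sqrt (2 ^ j) * sqrt (2 ^ j)) * sqrt (2 ^ Suc k) / 2 ^ Suc j" by (simp only: mult_ac times_divide_eq_right)
  also have "\<dots> = sqrt (2 ^ Suc k) / 2" by (subst real_sqrt_mult_self) simp
  finally show ?thesis using assms by simp
qed

section \<open>The lower bound for the convex hull\<close>

lemma gamma2_hull_T_set_ge: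
  assumes "2 < p" "1 \<le> r"
  shows "ennreal (1 / 2 * real r powr (3 / 2 - real_of_ereal (1 / p)))
    \<le> gamma2_norm (convex hull T_set p r (2 ^ (128 * r))) (lp_l2_norm p r (2 ^ (128 * r)))"
proof -
  define D :: nat where "D = 2 ^ (128 * r)"
  define K where "K = convex hull T_set p r D"
  define c where "c = real r powr (- real_of_ereal (1 / p))"
  define q :: "nat \<Rightarrow> nat" where "q i = 2 ^ (128 * r - i)" for i
  define X where "X i = {..<(2::nat) ^ i} \<rightarrow>\<^sub>E {..<q i}" for i :: nat
  \<comment> \<open>Closeness means differing in at most half of the \<open>2 ^ i\<close> groups;
    \<open>i - 1\<close> is a true predecessor because blocks start at 1.\<close>
  define R where "R i f g \<longleftrightarrow> card {b \<in> {..<(2::nat) ^ i}. f b \<noteq> g b} \<le> 2 ^ (i - 1)"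
    for i :: nat and f g :: "nat \<Rightarrow> nat"
  let ?N = "lp_l2_norm p r D" and ?pt = "code_point p r q"
  obtain k where k: "2 ^ k \<le> r" "r < 2 ^ Suc k" using ex_power_two_between[OF assms(2)] .
  have qD: "2 ^ i * q i = D" if "i \<in> {1..r}" for i
    using that by (simp add: q_def D_def flip: power_add)
  have X_funcset: "F i \<in> {..<2 ^ i} \<rightarrow> {..<q i}" if "F \<in> Pi\<^sub>E {1..r} X" "i \<in> {1..r}" for F i
    using that PiE_mem[OF that] by (auto simp: X_def)
  have pt_K: "?pt F \<in> K" if "F \<in> Pi\<^sub>E {1..r} X" for F
    unfolding K_def using that X_funcset qD by (intro code_point_mem_hull)
  have "ennreal (1 / 2 * real r powr (3 / 2 - real_of_ereal (1 / p))) \<le>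
      (SUP x\<in>K. \<Sum>n. ennreal (2 powr (real n / 2)) * ediam (\<lambda>x y. ?N (x - y)) (part_of (\<A> n) x))"
    if adm: "admissible K \<A>" for \<A>
  proof -
    have part: "partition_on K (\<A> n)" for n using adm by (simp add: admissible_def)
    \<comment> \<open>The label of \<open>F\<close> at scale \<open>i\<close> is its cell at level
      \<open>i + k\<close>. The shift by \<open>k\<close> gives the extra factor of about
      \<open>sqrt r\<close>, and \<open>2 ^ k \<le> r\<close> keeps the cells few enough for the
      count.\<close>
    define l where "l i F = part_of (\<A> (i + k)) (?pt F)" for i F
    have volume: "real (card (\<A> (i + k)) * (2 ^ 2 ^ i * q i ^ 2 ^ (i - 1))) \<le> (1 / 2) ^ i * card (X i)"
      if i: "i \<in> {1..r}" for i
    proof -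
      obtain j where j: "i = Suc j" using i by (cases i) auto
      have "card (\<A> (i + k)) * (2 ^ 2 ^ i * q i ^ 2 ^ j) * 2 ^ i
          \<le> 2 ^ 2 ^ (i + k) * (2 ^ 2 ^ i * q i ^ 2 ^ j) * 2 ^ i"
        using adm i by (intro mult_right_mono) (auto simp: admissible_def)
      also have "\<dots> = 2 ^ (2 ^ (i + k) + 2 ^ i + i) * q i ^ 2 ^ j"
        by (simp only: power_add mult_ac)
      also have "\<dots> \<le> 2 ^ ((128 * r - i) * 2 ^ j) * q i ^ 2 ^ j"
        using ball_volume_exponent_le[of j r k] i k(1) j
        by (intro mult_right_mono power_increasing) auto
      \<comment> \<open>The power of two is itself \<open>q i ^ 2 ^ j\<close>, so the two halves of
        the groups together make up all of \<open>X i\<close>.\<close>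
      also have "\<dots> = q i ^ (2 ^ j + 2 ^ j)"
        by (simp only: q_def power_mult power_add)
      also have "\<dots> = card (X i)" by (simp add: X_def card_PiE j mult_2)
      finally have "card (\<A> (i + k)) * (2 ^ 2 ^ i * q i ^ 2 ^ (i - 1)) * 2 ^ i \<le> card (X i)"
        using j by simp
      then have "real (card (\<A> (i + k)) * (2 ^ 2 ^ i * q i ^ 2 ^ (i - 1))) * 2 ^ i \<le> real (card (X i))"
        by (simp only: flip: of_nat_le_iff[where ?'a = real]) simp
      then show ?thesis by (simp only: power_one_over) (simp add: field_simps)
    qed
    obtain F where F: "F \<in> Pi\<^sub>E {1..r} X"
      "\<And>i. i \<in> {1..r} \<Longrightarrow> \<exists>G\<in>Pi\<^sub>E {1..r} X. l i G = l i F \<and> \<not> R i (F i) (G i)"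
    proof (rule ex_uncrowded[where I = "{1..r}" and X = X and L = "\<lambda>i. \<A> (i + k)" and l = l and R = R
          and \<beta> = "\<lambda>i. 2 ^ 2 ^ i * q i ^ 2 ^ (i - 1)" and w = "\<lambda>i. (1 / 2) ^ i"])
      fix i :: nat assume i: "i \<in> {1..r}"
      show "finite (X i)" "X i \<noteq> {}"
        by (auto simp: X_def q_def PiE_eq_empty_iff lessThan_empty_iff intro: finite_PiE)
      show "finite (\<A> (i + k))" using adm i by (auto simp: admissible_def)
      show "l i F \<in> \<A> (i + k)" if "F \<in> Pi\<^sub>E {1..r} X" for F
        unfolding l_def by (rule part_of_mem[OF part pt_K[OF that]])
      show "card {g \<in> X i. R i f g} \<le> 2 ^ 2 ^ i * q i ^ 2 ^ (i - 1)" for f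
        unfolding X_def R_def using card_hamming_ball_le[of "{..<2 ^ i}" "{..<q i}" f "2 ^ (i - 1)"]
        by (simp add: q_def lessThan_empty_iff)
    qed (use volume sum_half_powers_less in auto)
    have term_ge: "ennreal (c * (sqrt r / 2)) \<le>
        ennreal (2 powr (real (i + k) / 2)) * ediam (\<lambda>x y. ?N (x - y)) (part_of (\<A> (i + k)) (?pt F))"
      if i: "i \<in> {1..r}" for i
    proof -
      obtain j where j: "i = Suc j" using i by (cases i) auto
      obtain G where G: "G \<in> Pi\<^sub>E {1..r} X" "l i G = l i F" "\<not> R i (F i) (G i)" using F(2)[OF i] by blast
      let ?h = "card {b \<in> {..<(2::nat) ^ i}. F i b \<noteq> G i b}"
      have "2 ^ j \<le> ?h" using G(3) j by (simp add: R_def)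
      then have "real (2 ^ j) \<le> real ?h" by (simp only: of_nat_le_iff)
      then have "sqrt (2 ^ j) \<le> sqrt ?h" by simp
      then have "c * (sqrt (2 ^ j) / 2 ^ i) \<le> c * (sqrt ?h / 2 ^ i)"
        by (intro mult_left_mono divide_right_mono) (auto simp: c_def)
      also have "\<dots> \<le> ?N (?pt F - ?pt G)"
        unfolding c_def using assms i F(1) G(1) X_funcset qD by (intro code_point_dist_ge) auto
      finally have "ennreal (c * (sqrt (2 ^ j) / 2 ^ i)) \<le> ennreal (?N (?pt F - ?pt G))"
        by (rule ennreal_leI)
      also have "\<dots> \<le> ediam (\<lambda>x y. ?N (x - y)) (part_of (\<A> (i + k)) (?pt F))"
      proof (rule ediam_ge)
        show "?pt F \<in> part_of (\<A> (i + k)) (?pt F)" by (rule part_of_mem[OF part pt_K[OF F(1)]])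
        \<comment> \<open>Equal labels mean that both points lie in the same cell.\<close>
        show "?pt G \<in> part_of (\<A> (i + k)) (?pt F)"
          using part_of_mem(2)[OF part pt_K[OF G(1)], of "i + k"] G(2) unfolding l_def by (simp only:)
      qed
      finally have diam: "ennreal (c * (sqrt (2 ^ j) / 2 ^ i)) \<le>
          ediam (\<lambda>x y. ?N (x - y)) (part_of (\<A> (i + k)) (?pt F))" .
      have "real r \<le> real (2 ^ Suc k)" using k(2) by (simp only: of_nat_le_iff)
      then have "sqrt r / 2 \<le> 2 powr (real (i + k) / 2) * (sqrt (2 ^ j) / 2 ^ i)"
        unfolding j by (intro scale_contribution_ge) simp
      then have "c * (sqrt r / 2) \<le> c * (2 powr (real (i + k) / 2) * (sqrt (2 ^ j) / 2 ^ i))"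
        by (rule mult_left_mono) (simp add: c_def)
      also have "\<dots> = 2 powr (real (i + k) / 2) * (c * (sqrt (2 ^ j) / 2 ^ i))"
        by (rule mult.left_commute)
      finally have "ennreal (c * (sqrt r / 2)) \<le>
          ennreal (2 powr (real (i + k) / 2) * (c * (sqrt (2 ^ j) / 2 ^ i)))"
        by (rule ennreal_leI)
      also have "\<dots> = ennreal (2 powr (real (i + k) / 2)) * ennreal (c * (sqrt (2 ^ j) / 2 ^ i))"
        by (intro ennreal_mult) (auto simp: c_def)
      also have "\<dots> \<le> ennreal (2 powr (real (i + k) / 2)) *
          ediam (\<lambda>x y. ?N (x - y)) (part_of (\<A> (i + k)) (?pt F))"
        by (intro mult_left_mono diam) simp
      finally show ?thesis .
    qed
    let ?t = "\<lambda>n. ennreal (2 powr (real n / 2)) * ediam (\<lambda>x y. ?N (x - y)) (part_of (\<A> n) (?pt F))"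
    have "1 / 2 * real r powr (3 / 2 - real_of_ereal (1 / p)) = real r * (c * (sqrt r / 2))"
    proof -
      have "real r powr (3 / 2 - real_of_ereal (1 / p)) =
          real r powr (1 + (1 / 2 + - real_of_ereal (1 / p)))" by simp
      also have "\<dots> = real r * (sqrt r * c)"
        unfolding powr_add c_def using assms by (simp add: powr_half_sqrt)
      finally show ?thesis by simp
    qed
    then have "ennreal (1 / 2 * real r powr (3 / 2 - real_of_ereal (1 / p))) =
        (\<Sum>i=1..r. ennreal (c * (sqrt r / 2)))"
      by (simp only: sum_constant card_atLeastAtMost diff_Suc_1' Suc_eq_plus1 add_diff_cancel_right'
          ennreal_of_nat_eq_real_of_nat, subst ennreal_mult) (auto simp: c_def)
    also have "\<dots> \<le> (\<Sum>i=1..r. ?t (i + k))" by (rule sum_mono[OF term_ge])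
    \<comment> \<open>The levels \<open>i + k\<close> are distinct, so these are r different terms
      of the series at the single point \<open>?pt F\<close>; the rest are nonnegative.\<close>
    also have "\<dots> = sum ?t ((\<lambda>i. i + k) ` {1..r})" by (subst sum.reindex) auto
    also have "\<dots> \<le> (\<Sum>n. ?t n)" by (rule sum_le_suminf) auto
    also have "\<dots> \<le> (SUP x\<in>K. \<Sum>n. ennreal (2 powr (real n / 2)) *
        ediam (\<lambda>x y. ?N (x - y)) (part_of (\<A> n) x))"
      by (rule SUP_upper[OF pt_K[OF F(1)]])
    finally show ?thesis .
  qed
  then show ?thesis
    unfolding gamma2_norm_def gamma2_def D_def[symmetric] K_def[symmetric] by (intro INF_greatest) auto
qed

theorem theorem1p1:
  shows "\<exists>c C :: real. c > 0 \<and> C > 0 \<and>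
    (\<forall>(p::ereal) (r::nat). 2 < p \<longrightarrow> 2 \<le> r \<longrightarrow>
      (let D = 2 ^ (128 * r);
           Y = lp_l2_space r D;
           N = lp_l2_norm p r D;
           T = T_set p r D
       in T \<subseteq> {x \<in> Y. N x = 1} \<and>
          finite T \<and> card T = 2 ^ (128 * r\<^sup>2) \<and>
          gamma2_norm T N \<le> ennreal (C * real r) \<and>
          gamma2_norm (convex hull T) N \<ge>
            ennreal (c * real r powr (3/2 - real_of_ereal (1 / p)))))"
proof (rule exI[of _ "1 / 2"], rule exI[of _ 144], intro conjI allI impI)
  fix p :: ereal and r :: nat
  assume p: "2 < p" and "2 \<le> r"
  then have r: "1 \<le> r" by simp
  have "card (T_set p r (2 ^ (128 * r))) = 2 ^ (128 * r\<^sup>2)"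
    unfolding card_T_set[OF r] by (simp add: power2_eq_square mult.assoc flip: power_mult)
  then show "let D = 2 ^ (128 * r); Y = lp_l2_space r D; N = lp_l2_norm p r D; T = T_set p r D
       in T \<subseteq> {x \<in> Y. N x = 1} \<and>
          finite T \<and> card T = 2 ^ (128 * r\<^sup>2) \<and>
          gamma2_norm T N \<le> ennreal (144 * real r) \<and>
          gamma2_norm (convex hull T) N \<ge>
            ennreal (1 / 2 * real r powr (3/2 - real_of_ereal (1 / p)))"
    unfolding Let_def
    using T_set_subset_sphere[OF p r] finite_T_set gamma2_T_set_le[OF p r] gamma2_hull_T_set_ge[OF p r]
    by blast
qed simp_all

end
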